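(* For every non-negative integer $n$, $$\sum_{k=1}^{\lceil n/2\rceil}\binom n{2k-1}\frac1{2k+1}=\frac{2^{n+1}}{n+2}-\frac{2^n}{n+1}$$ and $$\sum_{k=1}^{\lceil n/2\rceil}\binom n{2k-1}\,2^{n-2k}\,C_k=\frac12\,C_{n+2}-C_{n+1}.$$
   Context: $C_j=\frac1{j+1}\binom{2j}j$ denotes the $j$-th Catalan number, for $j$ a non-negative integer. Binomial coefficients of non-negative integers are the usual ones (zero when the lower index exceeds the upper); empty sums are $0$. *)

theory Defs
  imports Complex_Main
begin

definition catalan :: "nat \<Rightarrow> real" where
  "catalan j = 1 / (real j + 1) * real ((2 * j) choose j)"

end

theory Submission
  imports Defs
begin

text \<open>
  For the first identity, absorption rewrites each summand as a combination of
  \<open>(n + 1) choose 2k\<close> and \<open>(n + 2) choose (2k + 1)\<close>, so only the even and odd parts of a row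
  sum of Pascal's triangle are needed. For the second, Pascal's rule applied to Touchard's identity
  \<open>C\<^sub>n\<^sub>+\<^sub>1 = (\<Sum>k. (n choose 2k) 2^(n - 2k) C\<^sub>k)\<close> at \<open>n + 1\<close> splits it into twice Touchard's sum
  at \<open>n\<close> and twice the sum in question. Touchard's identity itself follows by creative telescoping:
  its sum satisfies the recurrence \<open>(n + 3) C\<^sub>n\<^sub>+\<^sub>2 = (4n + 6) C\<^sub>n\<^sub>+\<^sub>1\<close>.
\<close>

text \<open>The subtraction is taken in the reals, so no bound on \<open>j\<close> is needed: for
  \<open>j > m\<close> both binomials vanish.\<close>

lemma of_nat_Suc_times_binomial_Suc:
  "(real j + 1) * real (m choose Suc j) = (real m - real j) * real (m choose j)"
proof (cases "j \<le> m")
  case True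
  have "Suc j * (m choose Suc j) = (m - j) * (m choose j)"
    using binomial_absorb_comp[of m j] binomial_absorption[of j m] by simp
  then have "real (Suc j) * real (m choose Suc j) = real (m - j) * real (m choose j)"
    by (metis of_nat_mult)
  then show ?thesis using True by (simp add: of_nat_diff add.commute)
qed (simp add: binomial_eq_0)

lemma of_nat_binomial_absorb_comp:
  "(real m + 1 - real j) * real (Suc m choose j) = (real m + 1) * real (m choose j)"
proof (cases j)
  case (Suc i)
  have "(real m - real i) * (real (m choose i) + real (m choose Suc i))
      = (real m + 1) * real (m choose Suc i)"
    using of_nat_Suc_times_binomial_Suc[of i m] by (simp add: algebra_simps)
  then show ?thesis using Suc by simp
qed simp

text \<open>Pascal's rule splits the central binomial of row \<open>2k + 2\<close> into two entries
  of row \<open>2k + 1\<close>, which are equal; each is a rational multiple of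
  \<open>(2 * k) choose k\<close>.\<close>

lemma catalan_Suc: "(real k + 2) * catalan (Suc k) = (4 * real k + 2) * catalan k"
proof -
  let ?b = "real ((2 * k) choose k)"
  have "(real k + 1) * real ((2 * k + 1) choose k) = (2 * real k + 1) * ?b"
    using of_nat_binomial_absorb_comp[of "2 * k" k] by simp
  moreover have "(real k + 1) * real ((2 * k + 1) choose Suc k)
      = (real k + 1) * real ((2 * k + 1) choose k)"
    using of_nat_Suc_times_binomial_Suc[of k "2 * k + 1"] by simp
  ultimately have "(real k + 1) * real ((2 * Suc k) choose Suc k) = (4 * real k + 2) * ?b"
    by (simp add: algebra_simps)
  then have "real ((2 * Suc k) choose Suc k) = (4 * real k + 2) * ?b / (real k + 1)"
    by (simp add: eq_divide_eq mult.commute del: binomial_Suc_Suc)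
  moreover have "(real k + 2) * catalan (Suc k) = real ((2 * Suc k) choose Suc k)"
    by (simp add: catalan_def add.commute del: binomial_Suc_Suc mult_Suc_right)
  ultimately show ?thesis by (simp add: catalan_def)
qed

text \<open>Writing \<open>2 ^ n / 4 ^ k\<close> avoids truncated subtraction in the exponent; terms
  with \<open>2 * k > n\<close> vanish through the binomial.\<close>

definition touchard_term :: "nat \<Rightarrow> nat \<Rightarrow> real" where
  "touchard_term n k = real (n choose (2 * k)) * 2 ^ n / 4 ^ k * catalan k"

text \<open>The certificate of Zeilberger's algorithm is
  \<open>- 8 k (k + 1) / (n + 1 - 2k)\<close> times \<open>touchard_term n k\<close>; absorbing the denominator into the
  binomial coefficient removes its pole at \<open>2k = n + 1\<close>.\<close>

definition touchard_cert :: "nat \<Rightarrow> nat \<Rightarrow> real" where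
  "touchard_cert n k =
     - 8 * real k * (real k + 1) / (real n + 1) * real (Suc n choose (2 * k)) * 2 ^ n / 4 ^ k * catalan k"

text \<open>All four terms are rational functions of \<open>n\<close> and \<open>k\<close> times the
  common factor \<open>b * c * 2 ^ n / 4 ^ k\<close>, so a polynomial identity remains.\<close>

lemma touchard_telescope:
  "(real n + 3) * touchard_term (Suc n) k - (4 * real n + 6) * touchard_term n k
     = touchard_cert n (Suc k) - touchard_cert n k"
proof -
  define x y where "x = real n" and "y = real k"
  define b where "b = real (Suc n choose (2 * k))"
  define c where "c = catalan k"
  have nz: "x + 1 \<noteq> 0" by (simp add: x_def add_eq_0_iff)
  have a: "real (n choose (2 * k)) = (x + 1 - 2 * y) * b / (x + 1)"
    using of_nat_binomial_absorb_comp[of n "2 * k"] nz by (simp add: b_def x_def y_def field_simps)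
  have d1: "(2 * y + 1) * real (Suc n choose (2 * k + 1)) = (x + 1 - 2 * y) * b"
    using of_nat_Suc_times_binomial_Suc[of "2 * k" "Suc n"] by (simp add: b_def x_def y_def add.commute)
  have d2: "2 * (y + 1) * real (Suc n choose (2 * Suc k))
      = (x - 2 * y) * real (Suc n choose (2 * k + 1))"
    using of_nat_Suc_times_binomial_Suc[of "2 * k + 1" "Suc n"]
    by (simp add: x_def y_def algebra_simps)
  have c1: "(y + 2) * catalan (Suc k) = 2 * (2 * y + 1) * c"
    using catalan_Suc[of k] by (simp add: c_def y_def algebra_simps)
  \<comment> \<open>The factor \<open>k * (k + 1)\<close> of the certificate, shifted to
    \<open>k + 1\<close>, clears the denominators of both the binomial ratio and the Catalan
    ratio.\<close>
  have "(y + 1) * (y + 2) * real (Suc n choose (2 * Suc k)) * catalan (Suc k)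
      = (2 * (y + 1) * real (Suc n choose (2 * Suc k))) * ((y + 2) * catalan (Suc k)) / 2"
    by simp
  also have "\<dots> = (x - 2 * y) * ((2 * y + 1) * real (Suc n choose (2 * k + 1))) * c"
    unfolding d2 c1 by simp
  also have "\<dots> = (x - 2 * y) * (x + 1 - 2 * y) * b * c"
    unfolding d1 by simp
  finally have e: "(y + 1) * (y + 2) * real (Suc n choose (2 * Suc k)) * catalan (Suc k)
      = (x - 2 * y) * (x + 1 - 2 * y) * b * c" .
  have "touchard_cert n (Suc k) = - 8 * (y + 1) * (y + 2) / (x + 1)
      * real (Suc n choose (2 * Suc k)) * 2 ^ n / (4 * 4 ^ k) * catalan (Suc k)"
    by (simp only: touchard_cert_def x_def y_def of_nat_Suc power_Suc) (simp add: add.commute)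
  also have "\<dots> = - 2 * ((y + 1) * (y + 2) * real (Suc n choose (2 * Suc k)) * catalan (Suc k))
      / (x + 1) * 2 ^ n / 4 ^ k"
    using nz by (simp add: divide_simps del: binomial_Suc_Suc mult_Suc_right)
      (simp add: algebra_simps del: binomial_Suc_Suc mult_Suc_right)
  finally have g1: "touchard_cert n (Suc k)
      = - 2 * ((x - 2 * y) * (x + 1 - 2 * y) * b * c) / (x + 1) * 2 ^ n / 4 ^ k"
    unfolding e .
  have g0: "touchard_cert n k = - 8 * y * (y + 1) / (x + 1) * b * 2 ^ n / 4 ^ k * c"
    by (simp only: touchard_cert_def b_def c_def x_def y_def)
  have f0: "touchard_term n k = (x + 1 - 2 * y) * b / (x + 1) * 2 ^ n / 4 ^ k * c"
    by (simp only: touchard_term_def a c_def)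
  have f1: "touchard_term (Suc n) k = b * (2 * 2 ^ n) / 4 ^ k * c"
    by (simp only: touchard_term_def b_def c_def power_Suc)
  have "(x + 3) * touchard_term (Suc n) k - (4 * x + 6) * touchard_term n k
     = touchard_cert n (Suc k) - touchard_cert n k"
    unfolding g1 g0 f0 f1 using nz by (simp add: divide_simps) (simp add: algebra_simps)
  then show ?thesis by (simp add: x_def)
qed

text \<open>The limit \<open>N\<close> is kept independent of \<open>n\<close>, so that the sums at
  \<open>n\<close> and \<open>n + 1\<close> have the same range in the induction.\<close>

lemma touchard:
  assumes "n \<le> 2 * N + 1"
  shows "(\<Sum>k\<le>N. touchard_term n k) = catalan (Suc n)"
  using assms
proof (induction n)
  case 0
  have "(\<Sum>k\<le>N. touchard_term 0 k) = (\<Sum>k\<le>N. if k = 0 then 1 else 0)"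
    by (rule sum.cong) (auto simp: touchard_term_def catalan_def binomial_eq_0)
  then show ?case by (simp add: catalan_def)
next
  case (Suc n)
  have "(real n + 3) * (\<Sum>k\<le>N. touchard_term (Suc n) k)
          - (4 * real n + 6) * (\<Sum>k\<le>N. touchard_term n k)
      = (\<Sum>k\<le>N. touchard_cert n (Suc k) - touchard_cert n k)"
    by (simp only: touchard_telescope[symmetric] sum_subtractf sum_distrib_left)
  also have "\<dots> = touchard_cert n (Suc N) - touchard_cert n 0"
    by (simp only: lessThan_Suc_atMost[symmetric] sum_lessThan_telescope)
  \<comment> \<open>The lower end has the factor \<open>k = 0\<close>; the upper end has the
    binomial \<open>Suc n choose (2 * N + 2)\<close>, and
    \<open>Suc n \<le> 2 * N + 1\<close>.\<close>
  also have "\<dots> = 0"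
    using Suc.prems by (simp add: touchard_cert_def binomial_eq_0 del: binomial_Suc_Suc)
  finally have "(real n + 3) * (\<Sum>k\<le>N. touchard_term (Suc n) k)
      = (4 * real n + 6) * catalan (Suc n)"
    using Suc by simp
  also have "\<dots> = (real n + 3) * catalan (Suc (Suc n))"
    using catalan_Suc[of "Suc n"] by (simp add: algebra_simps)
  finally show ?case by simp
qed

lemma sum_atMost_even_odd:
  fixes f :: "nat \<Rightarrow> 'a::comm_monoid_add"
  shows "(\<Sum>j\<le>2 * N + 1. f j) = (\<Sum>k\<le>N. f (2 * k)) + (\<Sum>k\<le>N. f (2 * k + 1))"
  by (induction N) (simp_all add: ac_simps)

lemma sum_binomial_row:
  assumes "m \<le> N"
  shows "(\<Sum>j\<le>N. m choose j) = 2 ^ m"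
proof -
  have "(\<Sum>j\<le>N. m choose j) = (\<Sum>j\<le>m. m choose j)"
    using assms by (intro sum.mono_neutral_right) (auto simp: binomial_eq_0)
  then show ?thesis by (simp add: choose_row_sum)
qed

text \<open>By Pascal's rule, each odd entry of row \<open>m + 1\<close> is the sum of two
  neighbours in row \<open>m\<close>, and these pairs exhaust row \<open>m\<close>.\<close>

lemma sum_binomial_odd:
  assumes "m \<le> 2 * N + 1"
  shows "(\<Sum>k\<le>N. Suc m choose (2 * k + 1)) = 2 ^ m"
  using sum_binomial_row[OF assms] sum_atMost_even_odd[of "(choose) m" N]
  by (simp add: sum.distrib)

lemma sum_binomial_even:
  assumes "m \<le> 2 * N"
  shows "(\<Sum>k\<le>N. Suc m choose (2 * k)) = 2 ^ m"
proof -
  have "(\<Sum>k\<le>N. Suc m choose (2 * k)) + (\<Sum>k\<le>N. Suc m choose (2 * k + 1)) = 2 ^ Suc m"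
    using assms sum_binomial_row[of "Suc m" "2 * N + 1"] sum_atMost_even_odd[of "(choose) (Suc m)" N]
    by simp
  then show ?thesis using sum_binomial_odd[of m N] assms by simp
qed

text \<open>Absorption gives \<open>a = 2k b / (n + 1)\<close> and
  \<open>c = (n + 2) b / (2k + 1)\<close>; then use
  \<open>2k / (2k + 1) = 1 - 1 / (2k + 1)\<close>.\<close>

lemma binomial_div_eq:
  assumes "k \<ge> 1"
  shows "real (n choose (2 * k - 1)) * (1 / (2 * real k + 1))
    = real (Suc n choose (2 * k)) / (real n + 1)
      - real (Suc (Suc n) choose (2 * k + 1)) / ((real n + 1) * (real n + 2))"
proof -
  have p: "2 * real k * real (Suc n choose (2 * k)) = (real n + 1) * real (n choose (2 * k - 1))"
    using assms arg_cong[OF Suc_times_binomial_eq[of n "2 * k - 1"], of real]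
    by (simp add: algebra_simps del: binomial_Suc_Suc)
  have q: "(2 * real k + 1) * real (Suc (Suc n) choose (2 * k + 1))
      = (real n + 2) * real (Suc n choose (2 * k))"
    using arg_cong[OF Suc_times_binomial_eq[of "Suc n" "2 * k"], of real]
    by (simp add: algebra_simps del: binomial_Suc_Suc)
  define a b c where "a = real (n choose (2 * k - 1))"
    and "b = real (Suc n choose (2 * k))" and "c = real (Suc (Suc n) choose (2 * k + 1))"
  have a: "a = 2 * real k * b / (real n + 1)" and c: "c = (real n + 2) * b / (2 * real k + 1)"
    using p q unfolding a_def[symmetric] b_def[symmetric] c_def[symmetric]
    by (simp_all add: eq_divide_eq mult.commute add_eq_0_iff)
  show ?thesis
    unfolding a_def[symmetric] b_def[symmetric] c_def[symmetric] a c
    by (simp add: divide_simps add_eq_0_iff) (simp add: algebra_simps)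
qed

theorem proposition1:
  fixes n :: nat
  shows "(\<Sum>k = 1..nat \<lceil>real n / 2\<rceil>. real (n choose (2 * k - 1)) * (1 / (2 * real k + 1)))
           = 2 ^ (n + 1) / (real n + 2) - 2 ^ n / (real n + 1)
       \<and> (\<Sum>k = 1..nat \<lceil>real n / 2\<rceil>.
             real (n choose (2 * k - 1)) * 2 powi (int n - 2 * int k) * catalan k)
           = 1 / 2 * catalan (n + 2) - catalan (n + 1)"
proof -
  define M where "M = nat \<lceil>real n / 2\<rceil>"
  have M: "n \<le> 2 * M" unfolding M_def by linarith
  have split0: "(\<Sum>k\<le>M. f k) = f 0 + (\<Sum>k = 1..M. f k)" for f :: "nat \<Rightarrow> real"
    by (simp add: atMost_atLeast0 sum.atLeast_Suc_atMost)

  let ?g = "\<lambda>k. real (Suc n choose (2 * k)) / (real n + 1)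
      - real (Suc (Suc n) choose (2 * k + 1)) / ((real n + 1) * (real n + 2))"
  have "(\<Sum>k = 1..M. real (n choose (2 * k - 1)) * (1 / (2 * real k + 1))) = (\<Sum>k = 1..M. ?g k)"
    by (intro sum.cong refl binomial_div_eq) simp
  \<comment> \<open>The added term \<open>?g 0\<close> is
    \<open>1 / (n + 1) - (n + 2) / ((n + 1) * (n + 2)) = 0\<close>.\<close>
  also have "\<dots> = (\<Sum>k\<le>M. ?g k)"
    unfolding split0 by (simp add: divide_simps)
  also have "\<dots> = real (\<Sum>k\<le>M. Suc n choose (2 * k)) / (real n + 1)
      - real (\<Sum>k\<le>M. Suc (Suc n) choose (2 * k + 1)) / ((real n + 1) * (real n + 2))"
    by (simp only: sum_subtractf sum_divide_distrib of_nat_sum)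
  also have "\<dots> = 2 ^ n / (real n + 1) - 2 ^ Suc n / ((real n + 1) * (real n + 2))"
    using M by (simp only: sum_binomial_even sum_binomial_odd) simp
  also have "\<dots> = 2 ^ (n + 1) / (real n + 2) - 2 ^ n / (real n + 1)"
    by (simp add: divide_simps add_eq_0_iff) (simp add: algebra_simps)
  finally have first: "(\<Sum>k = 1..M. real (n choose (2 * k - 1)) * (1 / (2 * real k + 1)))
      = 2 ^ (n + 1) / (real n + 2) - 2 ^ n / (real n + 1)" .

  let ?h = "\<lambda>k. real (n choose (2 * k - 1)) * 2 powi (int n - 2 * int k) * catalan k"
  have pascal: "touchard_term (Suc n) k = 2 * touchard_term n k + 2 * ?h k" if ge: "k \<ge> 1" for k
  proof -
    obtain j where "2 * k = Suc j" using ge by (cases k) auto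
    \<comment> \<open>For odd \<open>n\<close> the exponent reaches -1 at the last index, hence the
      integer power.\<close>
    moreover have "(2::real) powi (int n - 2 * int k) = 2 ^ n / 4 ^ k"
      by (simp add: power_int_diff power_int_mult)
    ultimately show ?thesis
      by (simp add: touchard_term_def field_simps)
  qed
  have "catalan (Suc (Suc n)) = (\<Sum>k\<le>M. touchard_term (Suc n) k)"
    using touchard[of "Suc n" M] M by simp
  \<comment> \<open>At \<open>k = 0\<close> the binomial is 1 in both rows, so only the power of 2
    doubles.\<close>
  also have "\<dots> = 2 * touchard_term n 0 + (\<Sum>k = 1..M. 2 * touchard_term n k + 2 * ?h k)"
    unfolding split0 using pascal by (simp add: touchard_term_def)
  also have "\<dots> = 2 * (\<Sum>k\<le>M. touchard_term n k) + 2 * (\<Sum>k = 1..M. ?h k)"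
    by (simp only: split0 sum.distrib sum_distrib_left distrib_left add.assoc)
  also have "\<dots> = 2 * catalan (Suc n) + 2 * (\<Sum>k = 1..M. ?h k)"
    using touchard[of n M] M by simp
  finally have "(\<Sum>k = 1..M. ?h k) = 1 / 2 * catalan (n + 2) - catalan (n + 1)"
    by (simp add: field_simps)
  with first show ?thesis unfolding M_def by blast
qed

end
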